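(* For every $m\ge1$, the fans $\mathcal{R}(\Delta_1,m)$ (in $\mathbb{R}^m$ with lattice $\mathbb{Z}^m$) and $\mathcal{Q}(\Delta_1,m+1)$ (in $\mathbb{R}^{m+1}/\mathbb{R}$ with lattice $\mathbb{Z}^{m+1}/\mathbb{Z}$) are isomorphic.
   Context: $\Delta_1=[0,1]$ is the one-dimensional simplex; its normal fan is $\Sigma=\{\mathbb{R}_{\ge0},\mathbb{R}_{\le0},\{0\}\}$ in $\mathbb{R}$. For $n\ge1$ let $\Sigma^n$ be the fan in $\mathbb{R}^n$ of all products $\tau_1\times\cdots\times\tau_n$, $\tau_i\in\Sigma$, and let $q\colon\mathbb{R}^n\to\mathbb{R}^n/\mathbb{R}$ be the quotient by the diagonal. The quotient fan $\mathcal{Q}(\Delta_1,n)$ in $\mathbb{R}^n/\mathbb{R}$ is the common refinement of the cones $q(\tau)$, $\tau\in\Sigma^n$: its cones are the closures of the classes of the equivalence relation $[\mathbf v]\sim[\mathbf w]$ iff for every $\tau\in\Sigma^n$ one has $[\mathbf v]\in q(\tau)\Leftrightarrow[\mathbf w]\in q(\tau)$. The fan $\mathcal{R}(\Delta_1,n)$ in $\mathbb{R}^n$ is $\{q^{-1}(\xi)\cap\tau\mid\xi\in\mathcal{Q}(\Delta_1,n),\ \tau\in\Sigma^n\}$. An isomorphism of fans is an isomorphism of the ambient lattices whose linear extension maps the cones of one fan bijectively onto the cones of the other. *)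

theory Defs
  imports "HOL-Analysis.Analysis"
begin

definition diag_rel :: "real^'n \<Rightarrow> real^'n \<Rightarrow> bool" where
  "diag_rel v w \<longleftrightarrow> (\<exists>c. v - w = vec c)"

lemma equivp_diag_rel: "equivp diag_rel"
proof (rule equivpI)
  show "reflp (diag_rel :: real^'n \<Rightarrow> _)"
    unfolding reflp_def diag_rel_def by (metis diff_self vec_0)
  show "symp (diag_rel :: real^'n \<Rightarrow> _)"
    unfolding symp_def diag_rel_def by (metis minus_diff_eq vec_neg)
  show "transp (diag_rel :: real^'n \<Rightarrow> _)"
    unfolding transp_def diag_rel_def by (metis diff_add_cancel add_diff_eq vec_add)
qed

quotient_type (overloaded) 'n diag_quot = "real^'n::finite" / diag_rel
  by (rule equivp_diag_rel)

lift_definition q_map :: "real^'n \<Rightarrow> 'n::finite diag_quot" is "\<lambda>v. v" .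

instantiation diag_quot :: (finite) real_vector
begin

lift_definition zero_diag_quot :: "'a diag_quot" is 0 .

lift_definition plus_diag_quot :: "'a diag_quot \<Rightarrow> 'a diag_quot \<Rightarrow> 'a diag_quot" is "(+)"
  unfolding diag_rel_def by (metis add_diff_add vec_add)

lift_definition uminus_diag_quot :: "'a diag_quot \<Rightarrow> 'a diag_quot" is uminus
  unfolding diag_rel_def by (metis minus_diff_minus vec_neg)

lift_definition minus_diag_quot :: "'a diag_quot \<Rightarrow> 'a diag_quot \<Rightarrow> 'a diag_quot" is "(-)"
  unfolding diag_rel_def by (metis diff_diff_eq diff_diff_eq2 add_diff_eq diff_add_eq vec_sub)

lift_definition scaleR_diag_quot :: "real \<Rightarrow> 'a diag_quot \<Rightarrow> 'a diag_quot" is scaleR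
  unfolding diag_rel_def
proof -
  fix r :: real and v w :: "real^'a"
  assume "\<exists>c. v - w = vec c"
  then obtain c where "v - w = vec c" ..
  then have "r *\<^sub>R v - r *\<^sub>R w = vec (r * c)"
    by (simp add: vec_eq_iff flip: right_diff_distrib)
  then show "\<exists>c. r *\<^sub>R v - r *\<^sub>R w = vec c" ..
qed

instance
proof
  fix a b c :: "'a diag_quot" and r s :: real
  have refl: "diag_rel v v" for v :: "real^'a"
    by (rule equivp_reflp[OF equivp_diag_rel])
  show "a + b + c = a + (b + c)" by transfer (simp add: refl add.assoc)
  show "a + b = b + a" by transfer (simp add: refl add.commute)
  show "0 + a = a" by transfer (simp add: refl)
  show "- a + a = 0" by transfer (simp add: refl)
  show "a - b = a + - b" by transfer (simp add: refl)
  show "r *\<^sub>R (a + b) = r *\<^sub>R a + r *\<^sub>R b" by transfer (simp add: refl scaleR_add_right)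
  show "(r + s) *\<^sub>R a = r *\<^sub>R a + s *\<^sub>R a" by transfer (simp add: refl scaleR_add_left)
  show "r *\<^sub>R s *\<^sub>R a = (r * s) *\<^sub>R a" by transfer (simp add: refl)
  show "1 *\<^sub>R a = a" by transfer (simp add: refl)
qed

end

text \<open>The quotient topology, which is the standard topology of this finite-dimensional space.\<close>

instantiation diag_quot :: (finite) topological_space
begin

definition open_diag_quot :: "'a diag_quot set \<Rightarrow> bool" where
  "open_diag_quot U \<longleftrightarrow> open (q_map -` U)"

instance
proof
  show "open (UNIV :: 'a diag_quot set)"
    by (simp add: open_diag_quot_def)
  show "open (S \<inter> T)" if "open S" "open T" for S T :: "'a diag_quot set"
    using that by (simp add: open_diag_quot_def open_Int)
  show "open (\<Union>K)" if "\<forall>S\<in>K. open S" for K :: "'a diag_quot set set"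
    using that by (simp add: open_diag_quot_def vimage_Union open_UN)
qed

end

text \<open>The normal fan of the segment $[0,1]$; \<open>Sigma_pow\<close> is its $n$-fold product fan, with the
  index type \<open>'n\<close> playing the role of \<open>{1..n}\<close>.\<close>

definition Sigma_fan :: "real set set" where
  "Sigma_fan = {{0..}, {..0}, {0}}"

definition Sigma_pow :: "(real^'n) set set" where
  "Sigma_pow = {{v. \<forall>i. v $ i \<in> \<tau> i} | \<tau>. \<forall>i. \<tau> i \<in> Sigma_fan}"

definition Q_equiv :: "('n::finite diag_quot \<times> 'n diag_quot) set" where
  "Q_equiv = {(v, w). \<forall>\<tau>\<in>Sigma_pow. v \<in> q_map ` \<tau> \<longleftrightarrow> w \<in> q_map ` \<tau>}"

text \<open>The quotient fan of $\Delta_1$ in $R^n/R$, the common refinement of the cones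
  \<open>q_map ` \<tau>\<close>.\<close>

definition Q_fan :: "'n::finite diag_quot set set" where
  "Q_fan = {closure C | C. C \<in> UNIV // Q_equiv}"

definition R_fan :: "(real^'n) set set" where
  "R_fan = {q_map -` \<xi> \<inter> \<tau> | \<xi> \<tau>. \<xi> \<in> Q_fan \<and> \<tau> \<in> Sigma_pow}"

definition int_lattice :: "(real^'n) set" where
  "int_lattice = {v. \<forall>i. v $ i \<in> \<int>}"

text \<open>Since the diagonal line meets $Z^n$ exactly in the diagonal copy of $Z$, the image of $Z^n$
  in the quotient is the lattice $Z^n/Z$.\<close>

definition quot_lattice :: "'n::finite diag_quot set" where
  "quot_lattice = q_map ` int_lattice"

definition lattice_iso ::
  "('a::real_vector \<Rightarrow> 'b::real_vector) \<Rightarrow> 'a set \<Rightarrow> 'b set \<Rightarrow> bool" where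
  "lattice_iso \<phi> L M \<longleftrightarrow>
    bij_betw \<phi> L M \<and> (\<forall>x\<in>L. \<forall>y\<in>L. \<phi> (x + y) = \<phi> x + \<phi> y)"

text \<open>The lattices are meant to span their ambient spaces, so that the linear extension \<open>f\<close> is
  unique.\<close>

definition fan_isomorphic ::
  "'a::real_vector set \<Rightarrow> 'a set set \<Rightarrow> 'b::real_vector set \<Rightarrow> 'b set set \<Rightarrow> bool" where
  "fan_isomorphic L F M G \<longleftrightarrow>
    (\<exists>\<phi> f. lattice_iso \<phi> L M \<and> linear f \<and> (\<forall>x\<in>L. f x = \<phi> x) \<and>
      bij_betw (\<lambda>C. f ` C) F G)"

end

(* Up to translation by the diagonal, the pieces of the quotient fan are the classes of vectors
  inducing the same weak order on coordinates, so Q_fan is the fan of the braid arrangement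
  x_i = x_j.  Adding an extra coordinate equal to 0 turns the sign conditions cutting out R_fan into
  order conditions against that coordinate; hence x |-> [(0, x)] carries R_fan to Q_fan. *)

theory Submission
  imports Defs
begin

text \<open>This is the closed cone of the braid fan whose relative interior contains
  \<open>v\<close>.\<close>

definition order_cone :: "real^'n \<Rightarrow> (real^'n) set" where
  "order_cone v = {w. \<forall>i j. v $ i \<le> v $ j \<longrightarrow> w $ i \<le> w $ j}"

section \<open>The diagonal quotient map\<close>

lemma q_map_eq_iff: "q_map v = q_map w \<longleftrightarrow> (\<exists>c. v - w = vec c)"
  by (simp add: q_map_def diag_quot.abs_eq_iff diag_rel_def)

lemma surj_q_map: "surj q_map"
  by (rule surjI[of _ rep_diag_quot]) (simp add: q_map_def Quotient_abs_rep[OF Quotient_diag_quot])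

lemma q_map_add: "q_map (v + w) = q_map v + q_map w"
  by (simp add: q_map_def plus_diag_quot.abs_eq)

lemma q_map_scaleR: "q_map (r *\<^sub>R v) = r *\<^sub>R q_map v"
  by (simp add: q_map_def scaleR_diag_quot.abs_eq)

lemma linear_q_map: "linear q_map"
  by (rule linearI) (simp_all add: q_map_add q_map_scaleR)

lemma continuous_q_map: "continuous_on UNIV q_map"
  by (simp add: continuous_on_open_vimage open_diag_quot_def)

lemma closed_diag_quot_iff: "closed T \<longleftrightarrow> closed (q_map -` T)"
  by (simp add: closed_def open_diag_quot_def vimage_Compl)

lemma q_map_mem_image_iff: "q_map v \<in> q_map ` S \<longleftrightarrow> (\<exists>c. v + vec c \<in> S)"
proof
  assume "q_map v \<in> q_map ` S"
  then obtain s where s: "s \<in> S" "q_map s = q_map v" by auto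
  then obtain c where "s - v = vec c" by (auto simp: q_map_eq_iff)
  then have "s = v + vec c" by (simp add: algebra_simps)
  with s(1) show "\<exists>c. v + vec c \<in> S" by blast
next
  assume "\<exists>c. v + vec c \<in> S"
  then obtain c where "v + vec c \<in> S" ..
  moreover have "q_map (v + vec c) = q_map v"
    by (auto simp: q_map_eq_iff)
  ultimately show "q_map v \<in> q_map ` S"
    by (metis imageI)
qed

text \<open>Coordinate comparisons are invariant under diagonal translation, so order cones are
  saturated for \<open>q_map\<close>.\<close>

lemma q_map_mem_image_order_cone: "q_map w \<in> q_map ` order_cone v \<longleftrightarrow> w \<in> order_cone v"
  by (simp add: q_map_mem_image_iff order_cone_def)

lemma vimage_q_map_order_cone: "q_map -` q_map ` order_cone v = order_cone v"
  unfolding vimage_def q_map_mem_image_order_cone by simp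

section \<open>The equivalence classes as weak orders\<close>

lemma Sigma_fan_distinct: "{0..} \<noteq> {..0::real}" "{0..} \<noteq> {0::real}" "{..0} \<noteq> {0::real}"
  using atLeast_iff[of 0 "1::real"] atMost_iff[of "-1" "0::real"] by force+

text \<open>This form separates the upper bound from the lower bound so that each can be treated on
  its own; the cone \<open>{0}\<close> carries both.\<close>

lemma Sigma_fan_mem_iff:
  assumes "T \<in> Sigma_fan"
  shows "x \<in> T \<longleftrightarrow> (T \<noteq> {0..} \<longrightarrow> x \<le> 0) \<and> (T \<noteq> {..0} \<longrightarrow> 0 \<le> x)"
proof -
  consider "T = {0..}" | "T = {..0}" | "T = {0}" using assms by (auto simp: Sigma_fan_def)
  then show ?thesis
    using Sigma_fan_distinct by cases (simp_all add: order_antisym_conv order_eq_iff[of x 0])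
qed

text \<open>If a translate of \<open>v\<close> lies in the product cone, every coordinate bounded
  above by 0 is at most every coordinate bounded below by 0. This depends only on the weak order, so
  \<open>w\<close> inherits it and can be translated until 0 separates the two groups.\<close>

lemma translate_mem_if_same_order:
  fixes v w :: "real^'n::finite"
  assumes \<tau>: "\<forall>i. \<tau> i \<in> Sigma_fan"
    and v: "\<forall>i. v $ i + c \<in> \<tau> i"
    and ord: "\<And>i j. v $ i \<le> v $ j \<Longrightarrow> w $ i \<le> w $ j"
  shows "\<exists>d. \<forall>i. w $ i + d \<in> \<tau> i"
proof -
  have mem: "x \<in> \<tau> i \<longleftrightarrow> (\<tau> i \<noteq> {0..} \<longrightarrow> x \<le> 0) \<and> (\<tau> i \<noteq> {..0} \<longrightarrow> 0 \<le> x)" for x i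
    using \<tau> by (intro Sigma_fan_mem_iff) simp
  \<comment> \<open>\<open>N\<close> collects the coordinates with upper bound 0. If there are none,
    subtracting the minimum of \<open>w\<close> suffices; otherwise the maximum of \<open>w\<close>
    over \<open>N\<close> is moved to 0.\<close>
  define N where "N = {i. \<tau> i \<noteq> {0..}}"
  show ?thesis
  proof (cases "N = {}")
    case True
    then have "\<forall>i. \<tau> i = {0..}" by (auto simp: N_def)
    moreover have "Min (range (($) w)) \<le> w $ i" for i by simp
    ultimately have "w $ i + - Min (range (($) w)) \<in> \<tau> i" for i by (simp del: minus_Min_eq_Max)
    then show ?thesis by blast
  next
    case False
    then have "Max (($) w ` N) \<in> ($) w ` N" by (intro Max_in) auto
    then obtain j where j: "j \<in> N" "w $ j = Max (($) w ` N)" by auto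
    have "w $ i + - w $ j \<in> \<tau> i" for i
    proof -
      have "w $ i + - w $ j \<le> 0" if "\<tau> i \<noteq> {0..}"
        using that j by (simp add: N_def)
      moreover have "0 \<le> w $ i + - w $ j" if "\<tau> i \<noteq> {..0}"
      proof -
        have "0 \<le> v $ i + c" using v that by (simp add: mem)
        moreover have "v $ j + c \<le> 0" using v j(1) by (simp add: mem N_def)
        ultimately show ?thesis using ord[of j i] by simp
      qed
      ultimately show ?thesis by (simp add: mem)
    qed
    then show ?thesis by blast
  qed
qed

text \<open>Each single comparison of coordinates is detected by one product cone; conversely, equal
  weak orders allow translation into the same product cones.\<close>

lemma Q_equiv_iff:
  fixes v w :: "real^'n::finite"
  shows "(q_map v, q_map w) \<in> Q_equiv \<longleftrightarrow> (\<forall>i j. v $ i \<le> v $ j \<longleftrightarrow> w $ i \<le> w $ j)"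
proof
  have le: "w $ i \<le> w $ j" if eq: "(q_map v, q_map w) \<in> Q_equiv" and le: "v $ i \<le> v $ j"
    for v w :: "real^'n" and i j
  proof (cases "i = j")
    case False
    \<comment> \<open>Translating \<open>v\<close> by \<open>- v $ i\<close> puts it into this test
      cone. Excluding \<open>j\<close> from the first case makes the cone nonnegative at
      \<open>j\<close> even when \<open>v $ j = v $ i\<close>, so any translate of \<open>w\<close>
      in it has coordinate \<open>i\<close> at most 0 and coordinate \<open>j\<close> at least
      0.\<close>
    define \<tau> where "\<tau> k = (if v $ k \<le> v $ i \<and> k \<noteq> j then {..0} else {0::real..})" for k
    let ?T = "{u::real^'n. \<forall>k. u $ k \<in> \<tau> k}"
    have "\<tau> k \<in> Sigma_fan" for k by (simp add: Sigma_fan_def \<tau>_def)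
    then have "?T \<in> Sigma_pow" by (auto simp: Sigma_pow_def)
    moreover have "v + vec (- v $ i) \<in> ?T" using le by (auto simp: \<tau>_def)
    moreover from this have "q_map v \<in> q_map ` ?T"
      by (metis q_map_mem_image_iff)
    ultimately have "q_map w \<in> q_map ` ?T"
      using eq by (simp add: Q_equiv_def)
    then obtain d where "w + vec d \<in> ?T"
      by (auto simp only: q_map_mem_image_iff)
    then have "w $ i + d \<in> \<tau> i" "w $ j + d \<in> \<tau> j" by auto
    with False show ?thesis by (simp add: \<tau>_def)
  qed simp
  assume "(q_map v, q_map w) \<in> Q_equiv"
  moreover from this have "(q_map w, q_map v) \<in> Q_equiv" by (simp add: Q_equiv_def)
  ultimately show "\<forall>i j. v $ i \<le> v $ j \<longleftrightarrow> w $ i \<le> w $ j" using le by blast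
next
  assume ord: "\<forall>i j. v $ i \<le> v $ j \<longleftrightarrow> w $ i \<le> w $ j"
  have "q_map v \<in> q_map ` T \<longleftrightarrow> q_map w \<in> q_map ` T" if "T \<in> Sigma_pow" for T
  proof -
    from that obtain \<tau> where T: "T = {u. \<forall>i. u $ i \<in> \<tau> i}" and \<tau>: "\<forall>i. \<tau> i \<in> Sigma_fan"
      by (auto simp: Sigma_pow_def)
    have "(\<exists>c. \<forall>i. v $ i + c \<in> \<tau> i) \<longleftrightarrow> (\<exists>c. \<forall>i. w $ i + c \<in> \<tau> i)"
    proof
      assume "\<exists>c. \<forall>i. v $ i + c \<in> \<tau> i"
      then obtain c where c: "\<forall>i. v $ i + c \<in> \<tau> i" ..
      from \<tau> c show "\<exists>c. \<forall>i. w $ i + c \<in> \<tau> i"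
        by (rule translate_mem_if_same_order) (simp add: ord)
    next
      assume "\<exists>c. \<forall>i. w $ i + c \<in> \<tau> i"
      then obtain c where c: "\<forall>i. w $ i + c \<in> \<tau> i" ..
      from \<tau> c show "\<exists>c. \<forall>i. v $ i + c \<in> \<tau> i"
        by (rule translate_mem_if_same_order) (simp add: ord)
    qed
    then show ?thesis by (simp add: q_map_mem_image_iff T)
  qed
  then show "(q_map v, q_map w) \<in> Q_equiv" by (simp add: Q_equiv_def)
qed

section \<open>Closures of the classes, and both fans in terms of order cones\<close>

lemma closed_order_cone: "closed (order_cone (v :: real^'n::finite))"
  unfolding order_cone_def
  by (intro closed_Collect_all closed_Collect_imp closed_Collect_le open_Collect_const continuous_intros)

text \<open>The order cone is closed and saturated, so its image is closed and contains the closure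
  of the class. Conversely, each of its points is a limit of points inducing exactly the weak order
  of \<open>v\<close>.\<close>

lemma closure_Q_class:
  fixes v :: "real^'n::finite"
  shows "closure (Q_equiv `` {q_map v}) = q_map ` order_cone v"
proof
  show "closure (Q_equiv `` {q_map v}) \<subseteq> q_map ` order_cone v"
  proof (rule closure_minimal)
    show "Q_equiv `` {q_map v} \<subseteq> q_map ` order_cone v"
    proof
      fix y assume y: "y \<in> Q_equiv `` {q_map v}"
      obtain w where "y = q_map w" using surj_q_map by (metis surjD)
      with y show "y \<in> q_map ` order_cone v" by (auto simp: Q_equiv_iff order_cone_def)
    qed
    show "closed (q_map ` order_cone v)"
      by (simp add: closed_diag_quot_iff vimage_q_map_order_cone closed_order_cone)
  qed
next
  let ?A = "{w. \<forall>i j. v $ i \<le> v $ j \<longleftrightarrow> w $ i \<le> w $ j}"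
  have "order_cone v \<subseteq> closure ?A"
  proof
    fix w assume w: "w \<in> order_cone v"
    \<comment> \<open>Adding a small positive multiple of \<open>v\<close> breaks the ties of
      \<open>w\<close> exactly where \<open>v\<close> is strict.\<close>
    let ?s = "\<lambda>n. w + inverse (real (Suc n)) *\<^sub>R v"
    have "?s n \<in> ?A" for n
    proof -
      have mono: "w $ i \<le> w $ j" if "v $ i \<le> v $ j" for i j
        using that w by (simp add: order_cone_def)
      have le: "?s n $ i \<le> ?s n $ j" if "v $ i \<le> v $ j" for i j
        using mono[OF that] that by (simp add: add_mono mult_left_mono)
      have less: "?s n $ i < ?s n $ j" if "v $ i < v $ j" for i j
        using mono[of i j] that by (simp add: add_le_less_mono mult_strict_left_mono)
      have "v $ i \<le> v $ j \<longleftrightarrow> ?s n $ i \<le> ?s n $ j" for i j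
        using le[of i j] less[of j i] by (meson not_le)
      then show ?thesis by blast
    qed
    moreover have "?s \<longlonglongrightarrow> w + 0 *\<^sub>R v"
      by (intro tendsto_intros LIMSEQ_inverse_real_of_nat)
    ultimately show "w \<in> closure ?A"
      unfolding closure_sequential by (intro exI[of _ ?s]) simp
  qed
  then have "q_map ` order_cone v \<subseteq> q_map ` closure ?A" by blast
  also have "\<dots> \<subseteq> closure (Q_equiv `` {q_map v})"
  proof (rule image_closure_subset)
    show "continuous_on (closure ?A) q_map"
      using continuous_q_map continuous_on_subset by blast
    have "q_map ` ?A \<subseteq> Q_equiv `` {q_map v}" by (auto simp: Q_equiv_iff)
    then show "q_map ` ?A \<subseteq> closure (Q_equiv `` {q_map v})" using closure_subset by blast
  qed simp
  finally show "q_map ` order_cone v \<subseteq> closure (Q_equiv `` {q_map v})" .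
qed

lemma Q_fan_eq: "(Q_fan :: 'n::finite diag_quot set set) = range (\<lambda>v. q_map ` order_cone v)"
proof -
  have "(UNIV :: 'n diag_quot set) // Q_equiv = (\<lambda>x. Q_equiv `` {x}) ` range q_map"
    unfolding surj_q_map by (rule quotient_def[THEN trans]) blast
  then show ?thesis
    unfolding Q_fan_def Setcompr_eq_image by (simp only: image_image closure_Q_class)
qed

lemma R_fan_eq: "(R_fan :: (real^'n::finite) set set) = {order_cone v \<inter> T | v T. T \<in> Sigma_pow}"
proof -
  have "(R_fan :: (real^'n) set set) = {q_map -` q_map ` order_cone v \<inter> T | v T. T \<in> Sigma_pow}"
    unfolding R_fan_def Q_fan_eq by blast
  then show ?thesis by (simp only: vimage_q_map_order_cone)
qed

text \<open>The point is obtained by summing, over all pairs of coordinates, an element of \<open>C\<close>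
  that separates the pair whenever there is one.\<close>

lemma cone_has_generic_point:
  fixes C :: "(real^'n::finite) set"
  assumes zero: "0 \<in> C" and add: "\<And>x y. x \<in> C \<Longrightarrow> y \<in> C \<Longrightarrow> x + y \<in> C"
    and cmp: "\<And>i j. (\<forall>x\<in>C. x $ i \<le> x $ j) \<or> (\<forall>x\<in>C. x $ j \<le> x $ i)"
  obtains v where "v \<in> C" "C \<subseteq> order_cone v"
proof -
  \<comment> \<open>The point 0 is the default for pairs of coordinates that no element of
    \<open>C\<close> separates.\<close>
  have "\<forall>p. \<exists>s\<in>C. (\<exists>x\<in>C. x $ fst p \<noteq> x $ snd p) \<longrightarrow> s $ fst p \<noteq> s $ snd p"
    using zero by blast
  then obtain s where sC: "s p \<in> C"
    and s: "\<And>x. x \<in> C \<Longrightarrow> x $ fst p \<noteq> x $ snd p \<Longrightarrow> s p $ fst p \<noteq> s p $ snd p" for p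
    by metis
  let ?v = "\<Sum>p\<in>UNIV. s p"
  have "sum s A \<in> C" if "finite A" for A
    using that by induction (auto simp: zero add sC)
  then have v: "?v \<in> C" by simp
  have "x $ i \<le> x $ j" if x: "x \<in> C" and le: "?v $ i \<le> ?v $ j" for x i j
  proof (rule ccontr)
    assume neg: "\<not> x $ i \<le> x $ j"
    with cmp x have ge: "\<forall>y\<in>C. y $ j \<le> y $ i" by blast
    moreover have "s (i, j) $ j \<noteq> s (i, j) $ i" using s[OF x, of "(i, j)"] neg by force
    ultimately have "s (i, j) $ j < s (i, j) $ i" using sC by (simp add: order_less_le)
    \<comment> \<open>All elements of \<open>C\<close> order this pair the same way, so no other
      summand can cancel the strict inequality contributed by \<open>s (i, j)\<close>.\<close>
    then have "(\<Sum>p\<in>UNIV. s p $ j) < (\<Sum>p\<in>UNIV. s p $ i)"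
      using ge sC by (intro sum_strict_mono_ex1) auto
    with le show False by simp
  qed
  then have "C \<subseteq> order_cone ?v" unfolding order_cone_def by blast
  with v show ?thesis by (rule that)
qed

section \<open>Identifying the smaller space with the quotient by inserting a zero
  coordinate\<close>

context
  fixes e :: "'m::finite \<Rightarrow> 'k::finite" and k0 :: 'k
  assumes inj_e: "inj e" and range_e: "range e = UNIV - {k0}"
begin

definition add_coord :: "real^'m \<Rightarrow> real^'k" where
  "add_coord x = (\<chi> j. if j = k0 then 0 else x $ inv e j)"

text \<open>Subtracting the coordinate at \<open>k0\<close> makes this constant on diagonal classes:
  it reads off the representative that vanishes at \<open>k0\<close>.\<close>

definition drop_coord :: "real^'k \<Rightarrow> real^'m" where
  "drop_coord u = (\<chi> i. u $ e i - u $ k0)"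

lemma add_coord_base [simp]: "add_coord x $ k0 = 0"
  by (simp add: add_coord_def)

lemma add_coord_e [simp]: "add_coord x $ e i = x $ i"
  using range_e inj_e by (auto simp: add_coord_def)

lemma all_coord_iff: "(\<forall>j. P j) \<longleftrightarrow> P k0 \<and> (\<forall>i. P (e i))"
  using range_e by (metis DiffI UNIV_I imageE singletonD)

lemma drop_add_coord: "drop_coord (add_coord x) = x"
  by (simp add: drop_coord_def vec_eq_iff)

lemma q_map_add_drop_coord: "q_map (add_coord (drop_coord u)) = q_map u"
proof -
  have "add_coord (drop_coord u) - u = vec (- u $ k0)"
    by (simp add: vec_eq_iff all_coord_iff drop_coord_def)
  then show ?thesis by (auto simp: q_map_eq_iff)
qed

lemma linear_q_map_add_coord: "linear (\<lambda>x. q_map (add_coord x))"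
proof -
  have "linear add_coord"
    by (rule linearI) (simp_all add: vec_eq_iff all_coord_iff)
  then show ?thesis using linear_compose[OF _ linear_q_map] by (simp add: o_def)
qed

lemma inj_q_map_add_coord: "inj (\<lambda>x. q_map (add_coord x))"
proof (rule injI)
  fix x y assume "q_map (add_coord x) = q_map (add_coord y)"
  then obtain c where c: "add_coord x - add_coord y = vec c" by (auto simp: q_map_eq_iff)
  \<comment> \<open>Both vectors vanish at \<open>k0\<close>, so a diagonal difference must be
    zero.\<close>
  from c have "c = 0" by (simp add: vec_eq_iff all_coord_iff)
  with c show "x = y" by (simp add: vec_eq_iff all_coord_iff)
qed

text \<open>Normalizing an integral vector to vanish at \<open>k0\<close> subtracts an integer, so
  every class in \<open>quot_lattice\<close> has an integral preimage.\<close>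

lemma image_int_lattice: "(\<lambda>x. q_map (add_coord x)) ` int_lattice = quot_lattice"
proof -
  have "add_coord x \<in> int_lattice" if "x \<in> int_lattice" for x
    using that by (simp add: int_lattice_def all_coord_iff)
  then have "q_map (add_coord x) \<in> quot_lattice" if "x \<in> int_lattice" for x
    using that by (simp add: quot_lattice_def)
  moreover have "q_map u \<in> (\<lambda>x. q_map (add_coord x)) ` int_lattice" if "u \<in> int_lattice" for u
  proof (rule image_eqI)
    show "q_map u = q_map (add_coord (drop_coord u))" by (simp only: q_map_add_drop_coord)
    show "drop_coord u \<in> int_lattice" using that by (simp add: int_lattice_def drop_coord_def)
  qed
  ultimately show ?thesis by (auto simp: quot_lattice_def)
qed

text \<open>Every class has a representative vanishing at \<open>k0\<close>, and saturation keeps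
  that representative inside the order cone.\<close>

lemma image_vimage_add_coord:
  "(\<lambda>x. q_map (add_coord x)) ` (add_coord -` order_cone v) = q_map ` order_cone v"
proof
  show "q_map ` order_cone v \<subseteq> (\<lambda>x. q_map (add_coord x)) ` (add_coord -` order_cone v)"
  proof
    fix y assume "y \<in> q_map ` order_cone v"
    then obtain u where "y = q_map u" "u \<in> order_cone v" by blast
    moreover have "add_coord (drop_coord u) \<in> order_cone v"
      using calculation(2) q_map_mem_image_order_cone q_map_add_drop_coord by metis
    ultimately show "y \<in> (\<lambda>x. q_map (add_coord x)) ` (add_coord -` order_cone v)"
      by (intro image_eqI[of _ _ "drop_coord u"]) (simp_all add: q_map_add_drop_coord)
  qed
qed auto

section \<open>Cones of \<open>R_fan\<close> as preimages of order cones\<close>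

lemma add_coord_mem_order_cone:
  "add_coord x \<in> order_cone v \<longleftrightarrow> x \<in> order_cone (drop_coord v) \<and>
    (\<forall>i. (v $ e i \<le> v $ k0 \<longrightarrow> x $ i \<le> 0) \<and> (v $ k0 \<le> v $ e i \<longrightarrow> 0 \<le> x $ i))"
  by (simp add: order_cone_def all_coord_iff drop_coord_def all_conj_distrib) blast

lemma vimage_order_cone_mem_R_fan: "add_coord -` order_cone v \<in> R_fan"
proof -
  let ?w = "drop_coord v"
  \<comment> \<open>\<open>\<tau> i\<close> is the smallest cone of \<open>Sigma_fan\<close>
    containing \<open>?w $ i\<close>; it encodes the comparisons of \<open>v\<close> between
    \<open>e i\<close> and \<open>k0\<close>.\<close>
  define \<tau> where "\<tau> i = (if ?w $ i > 0 then {0..} else if ?w $ i < 0 then {..0} else {0::real})" for i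
  have "\<tau> i \<in> Sigma_fan" for i by (simp add: Sigma_fan_def \<tau>_def)
  then have "{x::real^'m. \<forall>i. x $ i \<in> \<tau> i} \<in> Sigma_pow" by (auto simp: Sigma_pow_def)
  moreover have "add_coord x \<in> order_cone v \<longleftrightarrow> x \<in> order_cone ?w \<and> (\<forall>i. x $ i \<in> \<tau> i)" for x
  proof -
    have "x $ i \<in> \<tau> i \<longleftrightarrow> (v $ e i \<le> v $ k0 \<longrightarrow> x $ i \<le> 0) \<and> (v $ k0 \<le> v $ e i \<longrightarrow> 0 \<le> x $ i)" for i
      by (auto simp: \<tau>_def drop_coord_def)
    then show ?thesis by (simp add: add_coord_mem_order_cone)
  qed
  then have "add_coord -` order_cone v = order_cone ?w \<inter> {x. \<forall>i. x $ i \<in> \<tau> i}" by blast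
  ultimately show ?thesis unfolding R_fan_eq by blast
qed

lemma R_fan_eq_vimage_order_cone:
  assumes "C \<in> R_fan"
  obtains v where "C = add_coord -` order_cone v"
proof -
  from assms obtain w \<tau> where C: "C = order_cone w \<inter> {x. \<forall>i. x $ i \<in> \<tau> i}"
    and \<tau>: "\<And>i. \<tau> i \<in> Sigma_fan"
    by (auto simp: R_fan_eq Sigma_pow_def)
  have mem: "x \<in> \<tau> i \<longleftrightarrow> (\<tau> i \<noteq> {0..} \<longrightarrow> x \<le> 0) \<and> (\<tau> i \<noteq> {..0} \<longrightarrow> 0 \<le> x)" for x i
    using Sigma_fan_mem_iff[OF \<tau>] .
  have C_iff: "x \<in> C \<longleftrightarrow> x \<in> order_cone w \<and>
      (\<forall>i. (\<tau> i \<noteq> {0..} \<longrightarrow> x $ i \<le> 0) \<and> (\<tau> i \<noteq> {..0} \<longrightarrow> 0 \<le> x $ i))" for x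
    by (simp add: C mem)
  have add0: "add_coord 0 = 0" by (simp add: vec_eq_iff all_coord_iff)
  have add_add: "add_coord (x + y) = add_coord x + add_coord y" for x y
    by (simp add: vec_eq_iff all_coord_iff)
  have "0 \<in> C" by (simp add: C_iff order_cone_def)
  then have "0 \<in> add_coord ` C" using add0 by (rule image_eqI[rotated, OF _ sym])
  moreover have "x + y \<in> add_coord ` C" if "x \<in> add_coord ` C" "y \<in> add_coord ` C" for x y
  proof -
    have "a + b \<in> C" if ab: "a \<in> C" "b \<in> C" for a b
    proof -
      have "a + b \<in> order_cone w"
        using ab by (simp add: C_iff order_cone_def add_mono)
      moreover have "(a + b) $ i \<le> 0" if "\<tau> i \<noteq> {0..}" for i
        using ab that by (simp add: C_iff add_nonpos_nonpos)
      moreover have "0 \<le> (a + b) $ i" if "\<tau> i \<noteq> {..0}" for i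
        using ab that by (simp add: C_iff add_nonneg_nonneg)
      ultimately show ?thesis by (simp only: C_iff) blast
    qed
    with that show ?thesis by (auto simp flip: add_add)
  qed
  \<comment> \<open>Two old coordinates are compared uniformly on \<open>C\<close> by the order of
    \<open>w\<close>; an old coordinate and the new zero are compared by the sign condition in
    \<open>\<tau>\<close>.\<close>
  moreover have "(\<forall>x\<in>add_coord ` C. x $ i \<le> x $ j) \<or> (\<forall>x\<in>add_coord ` C. x $ j \<le> x $ i)" for i j
  proof -
    have "(\<forall>x\<in>C. x $ a \<le> x $ b) \<or> (\<forall>x\<in>C. x $ b \<le> x $ a)" for a b
      using linear[of "w $ a" "w $ b"] by (auto simp: C_iff order_cone_def)
    moreover have "(\<forall>x\<in>C. x $ a \<le> 0) \<or> (\<forall>x\<in>C. 0 \<le> x $ a)" for a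
      using Sigma_fan_distinct(1) by (cases "\<tau> a = {0..}") (simp_all add: C_iff)
    moreover have "i = k0 \<or> (\<exists>a. i = e a)" "j = k0 \<or> (\<exists>b. j = e b)"
      using range_e by blast+
    ultimately show ?thesis by (elim disjE exE) (simp_all, blast)
  qed
  ultimately obtain v where v: "v \<in> add_coord ` C" "add_coord ` C \<subseteq> order_cone v"
    by (rule cone_has_generic_point)
  from v(1) obtain z where z: "z \<in> C" "v = add_coord z" by blast
  \<comment> \<open>Every inequality defining \<open>C\<close> holds at \<open>z\<close>, hence is
    one of the comparisons imposed by \<open>order_cone v\<close>, and so passes to
    \<open>x\<close>.\<close>
  have "x \<in> C" if "add_coord x \<in> order_cone v" for x
  proof -
    have x: "x \<in> order_cone z" "\<And>i. z $ i \<le> 0 \<Longrightarrow> x $ i \<le> 0" "\<And>i. 0 \<le> z $ i \<Longrightarrow> 0 \<le> x $ i"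
      using that by (simp_all add: z(2) add_coord_mem_order_cone drop_add_coord)
    have "x \<in> order_cone w"
      using x(1) z(1) by (simp add: C_iff order_cone_def)
    moreover have "x $ i \<le> 0" if "\<tau> i \<noteq> {0..}" for i
      using z(1) that x(2) by (simp add: C_iff)
    moreover have "0 \<le> x $ i" if "\<tau> i \<noteq> {..0}" for i
      using z(1) that x(3) by (simp add: C_iff)
    ultimately show ?thesis by (simp only: C_iff) blast
  qed
  with v(2) have "C = add_coord -` order_cone v" by blast
  then show ?thesis by (rule that)
qed

section \<open>The isomorphism of fans\<close>

lemma fan_isomorphic_R_fan_Q_fan:
  "fan_isomorphic (int_lattice :: (real^'m) set) R_fan (quot_lattice :: 'k diag_quot set) Q_fan"
proof -
  let ?f = "\<lambda>x. q_map (add_coord x)"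
  have "(\<lambda>C. ?f ` C) ` R_fan = Q_fan"
  proof
    show "(\<lambda>C. ?f ` C) ` R_fan \<subseteq> Q_fan"
    proof (rule image_subsetI)
      fix C :: "(real^'m) set" assume "C \<in> R_fan"
      then obtain v where "C = add_coord -` order_cone v" by (rule R_fan_eq_vimage_order_cone)
      then show "?f ` C \<in> Q_fan" by (simp add: image_vimage_add_coord Q_fan_eq)
    qed
    show "Q_fan \<subseteq> (\<lambda>C. ?f ` C) ` R_fan"
    proof
      fix D :: "'k diag_quot set" assume "D \<in> Q_fan"
      then obtain v where "D = q_map ` order_cone v" by (auto simp: Q_fan_eq)
      then have "D = ?f ` (add_coord -` order_cone v)" by (simp only: image_vimage_add_coord)
      then show "D \<in> (\<lambda>C. ?f ` C) ` R_fan"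
        using vimage_order_cone_mem_R_fan by (rule image_eqI)
    qed
  qed
  moreover have "inj_on (\<lambda>C. ?f ` C) R_fan"
    using inj_q_map_add_coord by (simp add: inj_on_def inj_image_eq_iff)
  ultimately have "bij_betw (\<lambda>C. ?f ` C) R_fan Q_fan" by (simp add: bij_betw_def)
  moreover have "lattice_iso ?f int_lattice quot_lattice"
    using inj_on_subset[OF inj_q_map_add_coord subset_UNIV] image_int_lattice
    by (simp add: lattice_iso_def bij_betw_def linear_add[OF linear_q_map_add_coord])
  ultimately show ?thesis
    unfolding fan_isomorphic_def using linear_q_map_add_coord by (intro exI[of _ ?f]) simp
qed

end

theorem theorem1p5:
  fixes m :: nat
  assumes "m \<ge> 1" and "CARD('m::finite) = m" and "CARD('k::finite) = m + 1"
  shows "fan_isomorphic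
    (int_lattice :: (real^'m) set) R_fan
    (quot_lattice :: 'k diag_quot set) Q_fan"
proof -
  \<comment> \<open>\<open>undefined\<close> serves as an arbitrary choice of the extra index;
    removing it from the \<open>m + 1\<close> indices leaves \<open>m\<close>, which are matched
    with those of \<open>'m\<close>.\<close>
  have "\<exists>e. bij_betw e (UNIV :: 'm set) (UNIV - {undefined :: 'k})"
    by (rule finite_same_card_bij) (simp_all add: assms(2,3) card_Diff_singleton)
  then obtain e where "bij_betw e (UNIV :: 'm set) (UNIV - {undefined :: 'k})" ..
  then have "inj e" "range e = UNIV - {undefined}" by (simp_all add: bij_betw_def)
  then show ?thesis by (rule fan_isomorphic_R_fan_Q_fan)
qed

end
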